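(* Let $(X_k)_{k\in\mathbb{N}}$ be an independent sequence of nonnegative random variables on a probability space $(\Omega,\mathcal{F},\mathbb{P})$ with $\mathbb{E}[X_k]=1$ for all $k\in\mathbb{N}$. Define the process $S=(S_k)_{k\in\mathbb{N}_0}$ by $S_k=\prod_{\ell=1}^k X_\ell$ (so $S_0=1$) and the filtration $\mathbb{F}=(\mathcal{F}_k)_{k\in\mathbb{N}_0}$ by $\mathcal{F}_k:=\sigma(S_0,\dots,S_k)$. For $k\in\mathbb{N}$ set $$a_k:=\mathbb{P}[X_k<1]\in[0,1),\qquad b_k:=\mathbb{E}\big[X_k\mathbf{1}_{\{X_k<1\}}\big]\in[0,a_k].$$ Then $S$ is a nonnegative $(\mathbb{P},\mathbb{F})$-martingale. It is a bubble if and only if $$\sum_{k=1}^\infty a_k=\infty\quad\text{and}\quad\sum_{k=1}^\infty b_k<\infty.$$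
   Context: A nonnegative martingale $S=(S_k)_{k\in\mathbb{N}_0}$ converges $\mathbb{P}$-a.s. to an integrable random variable $S_\infty$; for a stopping time $\tau$ with values in $\mathbb{N}_0\cup\{\infty\}$, $S_\tau:=S_\infty$ on $\{\tau=\infty\}$. Convention: $\inf\emptyset=\infty$. Definition (bubble): put $\tau_0:=0$ and $\tau_k:=\inf\{j>\tau_{k-1}: S_j<S_{j-1}\}$ for $k\in\mathbb{N}$ (the $k$-th drawdown). The nonnegative martingale $S$ is a bubble (and $\mathbb{P}$ is a bubble measure for $S$) if $\mathbb{E}[S_{\tau_k}]<\mathbb{E}[S_0]$ for some $k\in\mathbb{N}$. *)

theory Defs
  imports "HOL-Probability.Probability"
begin

definition natural_filtration :: "'a measure \<Rightarrow> (nat \<Rightarrow> 'a \<Rightarrow> real) \<Rightarrow> nat \<Rightarrow> 'a measure" where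
  "natural_filtration M S k =
     sigma (space M) {S i -` A \<inter> space M | i A. i \<le> k \<and> A \<in> sets borel}"

definition martingale ::
  "'a measure \<Rightarrow> (nat \<Rightarrow> 'a measure) \<Rightarrow> (nat \<Rightarrow> 'a \<Rightarrow> real) \<Rightarrow> bool" where
  "martingale M F S \<longleftrightarrow>
     filtration (space M) F \<and>
     (\<forall>n. subalgebra M (F n)) \<and>
     (\<forall>n. S n \<in> borel_measurable (F n)) \<and>
     (\<forall>n. integrable M (S n)) \<and>
     (\<forall>m n. m \<le> n \<longrightarrow> (AE \<omega> in M. real_cond_exp M (F m) (S n) \<omega> = S m \<omega>))"

definition nonneg_martingale ::
  "'a measure \<Rightarrow> (nat \<Rightarrow> 'a measure) \<Rightarrow> (nat \<Rightarrow> 'a \<Rightarrow> real) \<Rightarrow> bool" where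
  "nonneg_martingale M F S \<longleftrightarrow>
     martingale M F S \<and> (\<forall>n. \<forall>\<omega>\<in>space M. 0 \<le> S n \<omega>)"

text \<open>A nonnegative martingale converges almost surely; on the null set where a path does not
  converge, the constant that \<^const>\<open>lim\<close> returns there is irrelevant for expectations.\<close>

definition stopped_value ::
  "(nat \<Rightarrow> 'a \<Rightarrow> real) \<Rightarrow> ('a \<Rightarrow> enat) \<Rightarrow> 'a \<Rightarrow> real" where
  "stopped_value S \<tau> \<omega> =
     (case \<tau> \<omega> of enat n \<Rightarrow> S n \<omega> | \<infinity> \<Rightarrow> lim (\<lambda>n. S n \<omega>))"

text \<open>In \<^typ>\<open>enat\<close> the infimum of the empty set is \<open>\<infinity>\<close>. The condition on \<open>j\<close> forces
  \<open>j \<ge> 1\<close>, so the subtraction below does not truncate.\<close>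

primrec drawdown_time :: "(nat \<Rightarrow> 'a \<Rightarrow> real) \<Rightarrow> nat \<Rightarrow> 'a \<Rightarrow> enat" where
  "drawdown_time S 0 \<omega> = 0"
| "drawdown_time S (Suc k) \<omega> =
     Inf {enat j | j. drawdown_time S k \<omega> < enat j \<and> S j \<omega> < S (j - 1) \<omega>}"

text \<open>By Fatou's lemma the stopped values of a nonnegative martingale are integrable, so the
  Bochner integral below is the expectation and never the default value for non-integrable
  functions.\<close>

definition bubble ::
  "'a measure \<Rightarrow> (nat \<Rightarrow> 'a measure) \<Rightarrow> (nat \<Rightarrow> 'a \<Rightarrow> real) \<Rightarrow> bool" where
  "bubble M F S \<longleftrightarrow>
     nonneg_martingale M F S \<and>
     (\<exists>k\<ge>1. (\<integral>\<omega>. stopped_value S (drawdown_time S k) \<omega> \<partial>M) < (\<integral>\<omega>. S 0 \<omega> \<partial>M))"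

end

theory Submission
  imports Defs
begin

text \<open>
  Write \<open>\<tau>\<close> for the \<open>k\<close>-th drawdown time. The process stopped at \<open>\<tau>\<close> has expectation \<open>1\<close> at every
  time \<open>n\<close>, so everything depends on whether mass is lost in the limit.

  If the \<open>a\<^sub>k\<close> are summable, then so are the expected absolute increments, being at most \<open>2 a\<^sub>k\<close>. The sum
  of the absolute increments then dominates the stopped process, and no mass is lost.

  If the \<open>a\<^sub>k\<close> are not summable, then almost surely infinitely many factors are below \<open>1\<close>, so \<open>S\<close> is
  eventually zero on \<open>\<tau> = \<infinity>\<close>, and the lost mass is the limit of the expectation of \<open>S\<^sub>n\<close> on \<open>n < \<tau>\<close>.
  If \<open>D\<^sub>n\<close> counts the drawdowns up to time \<open>n\<close>, independence gives
  \<open>E[S\<^sub>n c^D\<^sub>n] = \<Prod>(1 - (1 - c) b\<^sub>i)\<close>. With \<open>c = 0\<close> this is the mass for \<open>k = 1\<close>, which has a positive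
  limit if the \<open>b\<^sub>k\<close> are summable; with \<open>c = 1/2\<close> it bounds the mass up to the factor \<open>2^k\<close> and tends to
  zero if they are not.
\<close>

section \<open>Drawdown counts, drawdown times and stopped processes\<close>

text \<open>A finite sum in place of the recursive infimum: it is visibly determined by the path up
  to time \<open>n\<close> and suits induction on \<open>n\<close>.\<close>

definition drawdown_count :: "(nat \<Rightarrow> 'a \<Rightarrow> real) \<Rightarrow> nat \<Rightarrow> 'a \<Rightarrow> nat" where
  "drawdown_count S n \<omega> = (\<Sum>j<n. of_bool (S (Suc j) \<omega> < S j \<omega>))"

text \<open>\<open>enat\<close> is well-ordered, so the infimum of a nonempty set is attained; the
  empty set gives \<infinity>, which no \<open>enat n\<close> bounds.\<close>

lemma Inf_enat_le_iff: "Inf A \<le> enat n \<longleftrightarrow> (\<exists>j\<le>n. enat j \<in> A)"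
proof
  assume *: "Inf A \<le> enat n"
  then have "A \<noteq> {}"
    by (auto simp: Inf_enat_def)
  then have "Inf A \<in> A"
    by (auto simp: Inf_enat_def intro: LeastI)
  with * show "\<exists>j\<le>n. enat j \<in> A"
    by (cases "Inf A") auto
next
  assume "\<exists>j\<le>n. enat j \<in> A"
  then show "Inf A \<le> enat n"
    by (auto intro: Inf_lower2)
qed

text \<open>Induction on \<open>k\<close>: drawdown number \<open>k + 1\<close> has occurred by time
  \<open>n\<close> iff some downward step before \<open>n\<close> starts when at least
  \<open>k\<close> drawdowns are already counted.\<close>

lemma drawdown_time_le_iff:
  "drawdown_time S k \<omega> \<le> enat n \<longleftrightarrow> k \<le> drawdown_count S n \<omega>"
proof (induction k arbitrary: n)
  case 0
  then show ?case by (simp add: zero_enat_def)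
next
  case (Suc k)
  have "drawdown_time S (Suc k) \<omega> \<le> enat n \<longleftrightarrow>
      (\<exists>j\<le>n. drawdown_time S k \<omega> < enat j \<and> S j \<omega> < S (j - 1) \<omega>)"
    by (simp add: Inf_enat_le_iff)
  also have "\<dots> \<longleftrightarrow> (\<exists>j<n. k \<le> drawdown_count S j \<omega> \<and> S (Suc j) \<omega> < S j \<omega>)"
  proof -
    have "drawdown_time S k \<omega> < enat (Suc j) \<longleftrightarrow> k \<le> drawdown_count S j \<omega>" for j
      using Suc[of j] by (cases "drawdown_time S k \<omega>") auto
    \<comment> \<open>The index \<open>j = 0\<close> is excluded because no time lies below
      \<open>enat 0\<close>, so \<open>j\<close> is a successor and \<open>j - 1\<close> is a true
      predecessor.\<close>
    moreover have "(\<exists>j\<le>n. P j) \<longleftrightarrow> (\<exists>j<n. P (Suc j))" if "\<not> P 0" for P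
      using that by (metis Suc_le_eq not0_implies_Suc)
    ultimately show ?thesis by simp
  qed
  also have "\<dots> \<longleftrightarrow> Suc k \<le> drawdown_count S n \<omega>"
    by (induction n) (auto simp: drawdown_count_def less_Suc_eq)
  finally show ?case .
qed

lemma less_drawdown_time_iff:
  "enat n < drawdown_time S k \<omega> \<longleftrightarrow> drawdown_count S n \<omega> < k"
  using drawdown_time_le_iff[of S k \<omega> n] by (simp flip: not_le)

text \<open>\<open>the_enat\<close> is only reached for finite \<tau>: if \<tau> is \<infinity>, the
  first branch applies for every \<open>n\<close>.\<close>

definition stopped_process ::
  "(nat \<Rightarrow> 'a \<Rightarrow> real) \<Rightarrow> ('a \<Rightarrow> enat) \<Rightarrow> nat \<Rightarrow> 'a \<Rightarrow> real" where
  "stopped_process S \<tau> n \<omega> = (if enat n < \<tau> \<omega> then S n \<omega> else S (the_enat (\<tau> \<omega>)) \<omega>)"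

lemma stopped_process_0: "stopped_process S \<tau> 0 \<omega> = S 0 \<omega>"
  by (cases "\<tau> \<omega>") (auto simp: stopped_process_def)

lemma stopped_process_Suc:
  "stopped_process S \<tau> (Suc n) \<omega> =
     stopped_process S \<tau> n \<omega> + (if enat n < \<tau> \<omega> then S (Suc n) \<omega> - S n \<omega> else 0)"
  by (cases "\<tau> \<omega>") (auto simp: stopped_process_def not_less less_Suc_eq le_Suc_eq)

lemma stopped_process_tendsto:
  assumes "\<tau> \<omega> = \<infinity> \<Longrightarrow> convergent (\<lambda>n. S n \<omega>)"
  shows "(\<lambda>n. stopped_process S \<tau> n \<omega>) \<longlonglongrightarrow> stopped_value S \<tau> \<omega>"
proof (cases "\<tau> \<omega>")
  case (enat t)
  then have "eventually (\<lambda>n. stopped_process S \<tau> n \<omega> = stopped_value S \<tau> \<omega>) sequentially"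
    by (auto simp: stopped_process_def stopped_value_def intro!: eventually_sequentiallyI[of t])
  then show ?thesis
    by (rule tendsto_eventually)
next
  case infinity
  then show ?thesis
    using assms by (simp add: stopped_process_def stopped_value_def convergent_LIMSEQ_iff)
qed

text \<open>This holds even on divergent paths: for infinite \<tau> both sides are the same
  \<open>lim\<close>, and for finite \<tau> the stopped path is eventually constant. It serves to
  prove measurability.\<close>

lemma stopped_value_eq_lim: "stopped_value S \<tau> \<omega> = lim (\<lambda>n. stopped_process S \<tau> n \<omega>)"
proof (cases "\<tau> \<omega>")
  case (enat t)
  then show ?thesis
    using stopped_process_tendsto[of \<tau> \<omega> S] by (auto dest: limI)
qed (simp add: stopped_process_def stopped_value_def)

section \<open>The natural filtration\<close>

lemma sets_natural_filtration:
  "sets (natural_filtration M S k) =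
     sigma_sets (space M) {S i -` A \<inter> space M | i A. i \<le> k \<and> A \<in> sets borel}"
  unfolding natural_filtration_def by (rule sets_measure_of) auto

lemma space_natural_filtration [simp]: "space (natural_filtration M S k) = space M"
  by (simp add: natural_filtration_def space_measure_of_conv)

lemma filtration_natural_filtration: "filtration (space M) (natural_filtration M S)"
proof
  show "sets (natural_filtration M S i) \<le> sets (natural_filtration M S j)" if "i \<le> j" for i j
    unfolding sets_natural_filtration
    by (rule sigma_sets_mono') (use that order_trans in blast)
qed simp

lemma subalgebra_natural_filtration:
  assumes "\<And>n. S n \<in> borel_measurable M"
  shows "subalgebra M (natural_filtration M S k)"
  using assms by (auto simp: subalgebra_def sets_natural_filtration
      intro!: sets.sigma_sets_subset measurable_sets[OF assms])

lemma measurable_natural_filtration: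
  assumes "i \<le> k"
  shows "S i \<in> borel_measurable (natural_filtration M S k)"
  using assms by (auto simp: measurable_def sets_natural_filtration intro!: sigma_sets.Basic)

section \<open>Limits of products of \<open>1 - f i\<close>\<close>

text \<open>Each factor satisfies \<open>1 - x \<le> exp (- x)\<close>, so the product is at most
  the exponential of minus a partial sum, and these sums tend to infinity.\<close>

lemma prod_one_minus_tendsto_0:
  fixes f :: "nat \<Rightarrow> real"
  assumes f: "\<And>i. 0 \<le> f i" "\<And>i. f i \<le> 1" and "\<not> summable f"
  shows "(\<lambda>n. \<Prod>i<n. 1 - f i) \<longlonglongrightarrow> 0"
proof (rule tendsto_sandwich[where f = "\<lambda>_. 0" and h = "\<lambda>n. exp (- (\<Sum>i<n. f i))"])
  have "filterlim (\<lambda>n. \<Sum>i<n. f i) at_top sequentially"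
    unfolding filterlim_at_top
  proof
    fix Z :: real
    obtain n where "\<not> (\<Sum>i\<le>n. f i) \<le> Z"
      using bounded_imp_summable[of f Z, OF f(1)] \<open>\<not> summable f\<close> by blast
    then have "Z \<le> (\<Sum>i<Suc n. f i)"
      by (simp add: lessThan_Suc_atMost)
    moreover have "(\<Sum>i<Suc n. f i) \<le> (\<Sum>i<m. f i)" if "Suc n \<le> m" for m
      using that f(1) by (intro sum_mono2) auto
    ultimately show "eventually (\<lambda>n. Z \<le> (\<Sum>i<n. f i)) sequentially"
      by (meson eventually_sequentiallyI order_trans)
  qed
  then have "filterlim (\<lambda>n. - (\<Sum>i<n. f i)) at_bot sequentially"
    by (simp add: filterlim_uminus_at_top)
  then show "(\<lambda>n. exp (- (\<Sum>i<n. f i))) \<longlonglongrightarrow> 0"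
    by (rule filterlim_compose[OF exp_at_bot])
  have "(\<Prod>i<n. 1 - f i) \<le> exp (- (\<Sum>i<n. f i))" for n
  proof -
    have "(\<Prod>i<n. 1 - f i) \<le> (\<Prod>i<n. exp (- f i))"
      using f exp_ge_add_one_self[of "- f _"] by (intro prod_mono) (simp del: exp_minus)
    then show ?thesis
      by (simp add: exp_sum flip: sum_negf)
  qed
  then show "eventually (\<lambda>n. (\<Prod>i<n. 1 - f i) \<le> exp (- (\<Sum>i<n. f i))) sequentially"
    by simp
  show "eventually (\<lambda>n. 0 \<le> (\<Prod>i<n. 1 - f i)) sequentially"
    using f by (auto intro!: prod_nonneg always_eventually)
qed simp

text \<open>Summability makes the product converge in the strict sense, where the limit vanishes
  only if a factor does; \<open>f i < 1\<close> rules that out.\<close>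

lemma prod_one_minus_tendsto_pos:
  fixes f :: "nat \<Rightarrow> real"
  assumes f: "\<And>i. 0 \<le> f i" "\<And>i. f i < 1" and "summable f"
  obtains c where "0 < c" "(\<lambda>n. \<Prod>i<n. 1 - f i) \<longlonglongrightarrow> c"
proof -
  have "abs_convergent_prod (\<lambda>i. 1 - f i)"
    using assms by (intro summable_imp_abs_convergent_prod) simp
  then have conv: "convergent_prod (\<lambda>i. 1 - f i)"
    by (rule abs_convergent_prod_imp_convergent_prod)
  then have lim: "(\<lambda>n. \<Prod>i<n. 1 - f i) \<longlonglongrightarrow> prodinf (\<lambda>i. 1 - f i)"
    using convergent_prod_LIMSEQ[OF conv] by (simp add: LIMSEQ_lessThan_iff_atMost)
  have "0 \<le> prodinf (\<lambda>i. 1 - f i)"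
    using f by (intro LIMSEQ_le_const[OF lim]) (auto intro!: prod_nonneg simp: less_imp_le)
  moreover have "prodinf (\<lambda>i. 1 - f i) \<noteq> 0"
    using f by (intro prodinf_nonzero[OF conv]) (metis less_irrefl diff_gt_0_iff_gt)
  ultimately show thesis
    using that[OF _ lim] by linarith
qed

section \<open>The product process and the ranges of \<open>a\<close> and \<open>b\<close>\<close>

locale unit_mean_factors = prob_space +
  fixes X :: "nat \<Rightarrow> 'a \<Rightarrow> real"
  assumes indep: "indep_vars (\<lambda>_. borel) X {1..}"
    and X_nonneg: "\<And>k \<omega>. 1 \<le> k \<Longrightarrow> \<omega> \<in> space M \<Longrightarrow> 0 \<le> X k \<omega>"
    and X_integrable: "\<And>k. 1 \<le> k \<Longrightarrow> integrable M (X k)"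
    and X_expectation: "\<And>k. 1 \<le> k \<Longrightarrow> expectation (X k) = 1"
begin

definition S :: "nat \<Rightarrow> 'a \<Rightarrow> real" where
  "S k \<omega> = (\<Prod>l=1..k. X l \<omega>)"

abbreviation F :: "nat \<Rightarrow> 'a measure" where
  "F \<equiv> natural_filtration M S"

definition a :: "nat \<Rightarrow> real" where
  "a k = prob {\<omega> \<in> space M. X k \<omega> < 1}"

definition b :: "nat \<Rightarrow> real" where
  "b k = expectation (\<lambda>\<omega>. X k \<omega> * indicator {\<omega> \<in> space M. X k \<omega> < 1} \<omega>)"

text \<open>The successor index avoids \<open>X 0\<close>, about which nothing is assumed, so the
  rule has no side condition.\<close>

lemma X_Suc_measurable [measurable]: "X (Suc k) \<in> borel_measurable M"
  using X_integrable[of "Suc k"] by simp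

lemma X_measurable: "1 \<le> k \<Longrightarrow> X k \<in> borel_measurable M"
  using X_integrable[of k] by simp

lemma S_0 [simp]: "S 0 = (\<lambda>_. 1)"
  by (simp add: S_def fun_eq_iff)

lemma S_Suc: "S (Suc k) \<omega> = S k \<omega> * X (Suc k) \<omega>"
  by (simp add: S_def)

lemma S_measurable [measurable]: "S k \<in> borel_measurable M"
  by (induction k) (simp_all add: S_Suc[abs_def])

lemma S_nonneg: "\<omega> \<in> space M \<Longrightarrow> 0 \<le> S k \<omega>"
  by (auto simp: S_def intro!: prod_nonneg X_nonneg)

text \<open>Three choices of \<open>g\<close> occur: the identity for the moments of
  \<open>S\<close>, scaling by \<open>c\<close> below 1 to weight drawdowns, and the indicator of
  \<open>x \<ge> 1\<close> for runs without a factor below 1.\<close>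

lemma expectation_prod_comp:
  fixes g :: "real \<Rightarrow> real"
  assumes "finite I" "I \<subseteq> {1..}" "g \<in> borel_measurable borel"
    and "\<And>i. i \<in> I \<Longrightarrow> integrable M (\<lambda>\<omega>. g (X i \<omega>))"
  shows "integrable M (\<lambda>\<omega>. \<Prod>i\<in>I. g (X i \<omega>))"
    and "expectation (\<lambda>\<omega>. \<Prod>i\<in>I. g (X i \<omega>)) = (\<Prod>i\<in>I. expectation (\<lambda>\<omega>. g (X i \<omega>)))"
proof -
  have "indep_vars (\<lambda>_. borel) (\<lambda>i \<omega>. g (X i \<omega>)) I"
    using assms by (intro indep_vars_compose2[OF indep_vars_subset[OF indep]]) auto
  then show "integrable M (\<lambda>\<omega>. \<Prod>i\<in>I. g (X i \<omega>))"
    and "expectation (\<lambda>\<omega>. \<Prod>i\<in>I. g (X i \<omega>)) = (\<Prod>i\<in>I. expectation (\<lambda>\<omega>. g (X i \<omega>)))"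
    using assms by (auto intro: indep_vars_integrable indep_vars_lebesgue_integral)
qed

lemma S_integrable: "integrable M (S k)"
  using expectation_prod_comp(1)[of "{1..k}" "\<lambda>x. x"] X_integrable by (simp add: S_def[abs_def])

lemma S_expectation: "expectation (S k) = 1"
  using expectation_prod_comp(2)[of "{1..k}" "\<lambda>x. x"] X_integrable X_expectation
  by (simp add: S_def[abs_def])

lemma X_less_1_set: "1 \<le> k \<Longrightarrow> {\<omega> \<in> space M. X k \<omega> < 1} \<in> events"
  using X_measurable[of k] by measurable

lemma b_integrable:
  assumes "1 \<le> k"
  shows "integrable M (\<lambda>\<omega>. X k \<omega> * indicator {\<omega> \<in> space M. X k \<omega> < 1} \<omega>)"
  using integrable_real_mult_indicator[OF X_less_1_set[OF assms] X_integrable[OF assms]] .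

lemma a_eq_expectation:
  assumes "1 \<le> k"
  shows "a k = expectation (indicator {\<omega> \<in> space M. X k \<omega> < 1})"
  using X_less_1_set[OF assms] by (simp add: a_def Int_absorb2 subset_eq)

lemma b_nonneg: "1 \<le> k \<Longrightarrow> 0 \<le> b k"
  unfolding b_def by (rule integral_nonneg_AE) (auto intro!: AE_I2 mult_nonneg_nonneg X_nonneg)

lemma b_le_a:
  assumes "1 \<le> k"
  shows "b k \<le> a k"
  unfolding a_eq_expectation[OF assms] b_def
  using X_less_1_set[OF assms]
  by (intro integral_mono b_integrable[OF assms] integrable_real_indicator)
    (auto simp: emeasure_eq_measure split: split_indicator)

lemma a_nonneg: "0 \<le> a k"
  by (simp add: a_def)

text \<open>A factor almost surely below 1 would have mean strictly below 1.\<close>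

lemma a_less_1:
  assumes "1 \<le> k"
  shows "a k < 1"
proof (rule ccontr)
  assume "\<not> a k < 1"
  then have "a k = 1"
    using prob_le_1[of "{\<omega> \<in> space M. X k \<omega> < 1}"] by (simp add: a_def)
  then have AE: "AE \<omega> in M. X k \<omega> < 1"
    using X_less_1_set[OF assms] by (simp add: a_def prob_eq_1)
  have "expectation (X k) < expectation (\<lambda>_. 1)"
    using AE by (intro integral_less_AE_space X_integrable assms) (auto simp: emeasure_space_1)
  then show False
    using X_expectation[OF assms] by (simp add: prob_space)
qed

lemma a_b_range: "1 \<le> k \<Longrightarrow> a k \<in> {0..<1} \<and> b k \<in> {0..a k}"
  using a_nonneg a_less_1 b_nonneg b_le_a by auto

section \<open>Independence of the past and the martingale property\<close>

lemma subalgebra_F: "subalgebra M (F k)"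
  by (rule subalgebra_natural_filtration) simp

lemma F_imp_measurable: "f \<in> borel_measurable (F k) \<Longrightarrow> f \<in> borel_measurable M"
  by (rule measurable_from_subalg[OF subalgebra_F])

text \<open>Each \<open>S i\<close> with \<open>i \<le> k\<close> is a product of the first factors,
  hence measurable for the sigma-algebra these generate.\<close>

lemma sets_F_subset:
  "sets (F k) \<subseteq> sigma_sets (space M) (\<Union>i\<in>{1..k}. {X i -` A \<inter> space M | A. A \<in> sets borel})"
    (is "_ \<subseteq> ?E")
proof -
  define N where "N = sigma (space M) (\<Union>i\<in>{1..k}. {X i -` A \<inter> space M | A. A \<in> sets borel})"
  have sets_N: "sets N = ?E" and space_N: "space N = space M"
    unfolding N_def by (auto intro!: sets_measure_of space_measure_of)
  have X_N: "X i \<in> borel_measurable N" if "i \<in> {1..k}" for i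
    using that by (fastforce simp: measurable_def sets_N space_N intro!: sigma_sets.Basic)
  have S_N: "S i \<in> borel_measurable N" if "i \<le> k" for i
    unfolding S_def[abs_def] using that by (intro borel_measurable_prod X_N) auto
  have "{S i -` A \<inter> space M | i A. i \<le> k \<and> A \<in> sets borel} \<subseteq> sets N"
    using measurable_sets[OF S_N] by (auto simp: space_N)
  then show ?thesis
    using sets.sigma_sets_subset[of _ N] by (simp add: sets_natural_filtration sets_N space_N)
qed

text \<open>Independent generators are grouped into the disjoint index blocks \<open>{1..n}\<close>
  for the past and \<open>{Suc n}\<close> for the next factor, with a boolean naming the
  block.\<close>

lemma indep_set_F_X:
  "indep_set (sets (F n)) (sigma_sets (space M) {X (Suc n) -` A \<inter> space M | A. A \<in> sets borel})"
proof -
  let ?E = "\<lambda>i. {X i -` A \<inter> space M | A. A \<in> sets borel}"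
  let ?I = "\<lambda>j. if j then {1..n} else {Suc n}"
  have "indep_sets (\<lambda>j. sigma_sets (space M) (\<Union>i\<in>?I j. ?E i)) UNIV"
  proof (rule indep_sets_collect_sigma)
    have "indep_sets ?E {1..}"
      using indep by (simp add: indep_vars_def2)
    then show "indep_sets ?E (\<Union>j\<in>UNIV. ?I j)"
      by (rule indep_sets_mono_index[rotated]) (auto simp: UNIV_bool)
    show "Int_stable (?E i)" for i
      by (auto simp: Int_stable_def) (metis sets.Int vimage_Int Int_assoc Int_left_commute Int_absorb)
    show "disjoint_family_on ?I UNIV"
      by (auto simp: disjoint_family_on_def)
  qed
  then show ?thesis
    unfolding indep_set_def
    by (rule indep_sets_mono_sets) (use sets_F_subset[of n] in \<open>auto split: bool.split\<close>)
qed

lemma indep_var_F_X: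
  assumes "Z \<in> borel_measurable (F n)"
  shows "indep_var borel Z borel (X (Suc n))"
  unfolding indep_var_eq
proof (intro conjI)
  have "{Z -` A \<inter> space M | A. A \<in> sets borel} \<subseteq> sets (F n)"
    using measurable_sets[OF assms] by auto
  then have "sigma_sets (space M) {Z -` A \<inter> space M | A. A \<in> sets borel} \<subseteq> sets (F n)"
    using sets.sigma_sets_subset[of _ "F n"] by simp
  then show "indep_set (sigma_sets (space M) {Z -` A \<inter> space M | A. A \<in> sets borel})
      (sigma_sets (space M) {X (Suc n) -` A \<inter> space M | A. A \<in> sets borel})"
    using indep_set_F_X[of n] unfolding indep_sets2_eq by blast
qed (use F_imp_measurable[OF assms] in auto)

text \<open>The one-step rule behind the martingale property and optional stopping: a quantity known
  at time \<open>n\<close> factors out of the expectation against the next \<open>X\<close>.\<close>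

lemma
  assumes "Z \<in> borel_measurable (F n)" "integrable M Z"
    and "g \<in> borel_measurable borel" "integrable M (\<lambda>\<omega>. g (X (Suc n) \<omega>) :: real)"
  shows integrable_mult_comp_X: "integrable M (\<lambda>\<omega>. Z \<omega> * g (X (Suc n) \<omega>))"
    and expectation_mult_comp_X:
      "expectation (\<lambda>\<omega>. Z \<omega> * g (X (Suc n) \<omega>)) = expectation Z * expectation (\<lambda>\<omega>. g (X (Suc n) \<omega>))"
proof -
  have "indep_var borel Z borel (\<lambda>\<omega>. g (X (Suc n) \<omega>))"
    using indep_var_compose[OF indep_var_F_X[OF assms(1)] measurable_ident assms(3)]
    by (simp add: comp_def)
  then show "integrable M (\<lambda>\<omega>. Z \<omega> * g (X (Suc n) \<omega>))"
    and "expectation (\<lambda>\<omega>. Z \<omega> * g (X (Suc n) \<omega>)) = expectation Z * expectation (\<lambda>\<omega>. g (X (Suc n) \<omega>))"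
    using assms by (auto intro: indep_var_integrable indep_var_lebesgue_integral)
qed

lemma
  assumes "Z \<in> borel_measurable (F n)" "integrable M Z"
  shows integrable_mult_X: "integrable M (\<lambda>\<omega>. Z \<omega> * X (Suc n) \<omega>)"
    and expectation_mult_X: "expectation (\<lambda>\<omega>. Z \<omega> * X (Suc n) \<omega>) = expectation Z"
  using integrable_mult_comp_X[OF assms, of "\<lambda>x. x"] expectation_mult_comp_X[OF assms, of "\<lambda>x. x"]
    X_integrable[of "Suc n"] X_expectation[of "Suc n"] by simp_all

lemma S_measurable_F: "i \<le> n \<Longrightarrow> S i \<in> borel_measurable (F n)"
  by (rule measurable_natural_filtration)

text \<open>A conditional expectation is identified by its integrals over sets \<open>A\<close> of
  \<open>F m\<close>. Since \<open>A\<close> also lies in each later \<open>F n\<close>, one further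
  mean-one factor leaves the integral over \<open>A\<close> unchanged.\<close>

lemma nonneg_martingale_S: "nonneg_martingale M F S"
  unfolding nonneg_martingale_def martingale_def
proof (intro conjI allI ballI impI)
  fix m n :: nat assume "m \<le> n"
  interpret sub: finite_measure_subalgebra M "F m"
    by standard (rule subalgebra_F)
  show "AE \<omega> in M. real_cond_exp M (F m) (S n) \<omega> = S m \<omega>"
  proof (rule sub.real_cond_exp_charact)
    fix A assume A: "A \<in> sets (F m)"
    show "(\<integral>\<omega>\<in>A. S n \<omega> \<partial>M) = (\<integral>\<omega>\<in>A. S m \<omega> \<partial>M)"
      using \<open>m \<le> n\<close>
    proof (induction n rule: dec_induct)
      case (step n)
      have A_n: "A \<in> sets (F n)"
        using A filtration.sets_F_mono[OF filtration_natural_filtration step(1)] by blast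
      then have A_M: "A \<in> events"
        using subalgebra_F[of n] by (auto simp: subalgebra_def)
      have "(\<integral>\<omega>\<in>A. S (Suc n) \<omega> \<partial>M) = expectation (\<lambda>\<omega>. (indicator A \<omega> * S n \<omega>) * X (Suc n) \<omega>)"
        by (simp add: set_lebesgue_integral_def S_Suc mult.assoc)
      also have "\<dots> = expectation (\<lambda>\<omega>. indicator A \<omega> * S n \<omega>)"
        using A_n A_M S_measurable_F[of n n] integrable_mult_indicator[OF A_M S_integrable]
        by (intro expectation_mult_X) auto
      finally show ?case
        using step(3) by (simp add: set_lebesgue_integral_def)
    qed simp
  qed (auto intro: S_integrable S_measurable_F)
qed (auto intro: filtration_natural_filtration subalgebra_F S_measurable_F S_integrable S_nonneg)

section \<open>Optional stopping and the mass surviving before a drawdown\<close>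

lemma drawdown_count_measurable_F:
  assumes "i \<le> n"
  shows "drawdown_count S i \<in> measurable (F n) (count_space UNIV)"
  using assms
proof (induction i)
  case (Suc i)
  then have [measurable]: "S i \<in> borel_measurable (F n)" "S (Suc i) \<in> borel_measurable (F n)"
    "drawdown_count S i \<in> measurable (F n) (count_space UNIV)"
    by (auto intro: S_measurable_F)
  have "drawdown_count S (Suc i) = (\<lambda>\<omega>. if S (Suc i) \<omega> < S i \<omega> then Suc (drawdown_count S i \<omega>) else drawdown_count S i \<omega>)"
    by (auto simp: drawdown_count_def)
  then show ?case
    by simp
qed (simp add: drawdown_count_def[abs_def])

text \<open>A real-valued indicator, so that it can be multiplied into \<open>S n\<close> under the
  expectation.\<close>

definition survives :: "nat \<Rightarrow> nat \<Rightarrow> 'a \<Rightarrow> real" where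
  "survives k n \<omega> = of_bool (enat n < drawdown_time S k \<omega>)"

lemma survives_measurable_F: "survives k n \<in> borel_measurable (F n)"
proof -
  note [measurable] = drawdown_count_measurable_F[OF order_refl, of n]
  show ?thesis
    unfolding survives_def[abs_def] less_drawdown_time_iff by measurable
qed

lemma survives_measurable [measurable]: "survives k n \<in> borel_measurable M"
  by (rule F_imp_measurable[OF survives_measurable_F])

lemma S_survives_measurable_F: "(\<lambda>\<omega>. S n \<omega> * survives k n \<omega>) \<in> borel_measurable (F n)"
  using S_measurable_F[of n n] survives_measurable_F[of k n] by simp

lemma S_survives_integrable: "integrable M (\<lambda>\<omega>. S n \<omega> * survives k n \<omega>)"
  by (rule Bochner_Integration.integrable_bound[OF S_integrable[of n]])
    (use survives_measurable[of k n] in \<open>measurable, auto simp: survives_def\<close>)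

text \<open>Optional stopping at a finite time: the increment is \<open>S n * survives k n\<close>
  times \<open>X (Suc n) - 1\<close>, where the first part is known at time \<open>n\<close> and the
  second has mean zero.\<close>

lemma
  shows stopped_process_integrable: "integrable M (stopped_process S (drawdown_time S k) n)" (is "?int n")
    and stopped_process_expectation:
      "expectation (stopped_process S (drawdown_time S k) n) = 1" (is "?exp n")
proof -
  have "?int n \<and> ?exp n"
  proof (induction n)
    case 0
    then show ?case
      by (simp add: stopped_process_0[abs_def] prob_space)
  next
    case (Suc n)
    have "stopped_process S (drawdown_time S k) (Suc n) \<omega> =
        stopped_process S (drawdown_time S k) n \<omega> +
        (S n \<omega> * survives k n \<omega> * X (Suc n) \<omega> - S n \<omega> * survives k n \<omega>)" for \<omega>
      by (simp add: stopped_process_Suc survives_def S_Suc)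
    then show ?case
      using Suc S_survives_integrable[of n k]
        integrable_mult_X[OF S_survives_measurable_F S_survives_integrable, of n k]
        expectation_mult_X[OF S_survives_measurable_F S_survives_integrable, of n k]
      by simp
  qed
  then show "?int n" "?exp n" by auto
qed

lemma stopped_value_measurable: "stopped_value S (drawdown_time S k) \<in> borel_measurable M"
  unfolding stopped_value_eq_lim[abs_def]
  using borel_measurable_integrable[OF stopped_process_integrable]
  by (rule borel_measurable_lim_metric)

text \<open>After \<open>S\<close> has hit zero, factors below one are no longer drawdowns; the prefactor \<open>S n \<omega>\<close>
  removes this discrepancy.\<close>

lemma S_mult_power_drawdown_count:
  assumes "\<omega> \<in> space M"
  shows "S n \<omega> * c ^ drawdown_count S n \<omega> =
    (\<Prod>l=1..n. if X l \<omega> < 1 then c * X l \<omega> else X l \<omega>)"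
proof (induction n)
  case (Suc n)
  have "S (Suc n) \<omega> * c ^ drawdown_count S (Suc n) \<omega> =
      S n \<omega> * c ^ drawdown_count S n \<omega> *
      (if X (Suc n) \<omega> < 1 then c * X (Suc n) \<omega> else X (Suc n) \<omega>)"
  proof (cases "S n \<omega> = 0")
    case False
    then have "S (Suc n) \<omega> < S n \<omega> \<longleftrightarrow> X (Suc n) \<omega> < 1"
      using S_nonneg[OF assms, of n] by (simp add: S_Suc mult_less_cancel_left2)
    then show ?thesis
      by (simp add: drawdown_count_def S_Suc)
  qed (simp add: S_Suc)
  then show ?case
    using Suc by simp
qed (simp add: drawdown_count_def)

text \<open>Pathwise the weighted process is a product of independent factors
  \<open>g (X l)\<close>. Each differs from \<open>X l\<close> only below 1, by
  \<open>(1 - c) * X l\<close>, so its mean is \<open>1 - (1 - c) * b l\<close>.\<close>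

lemma
  shows S_mult_power_drawdown_count_integrable:
      "integrable M (\<lambda>\<omega>. S n \<omega> * c ^ drawdown_count S n \<omega>)"
    and S_mult_power_drawdown_count_expectation:
      "expectation (\<lambda>\<omega>. S n \<omega> * c ^ drawdown_count S n \<omega>) = (\<Prod>i<n. 1 - (1 - c) * b (Suc i))"
proof -
  define g :: "real \<Rightarrow> real" where "g x = (if x < 1 then c * x else x)" for x
  have [measurable]: "g \<in> borel_measurable borel"
    unfolding g_def by measurable
  have g_X: "g (X l \<omega>) = X l \<omega> - (1 - c) * (X l \<omega> * indicator {\<omega> \<in> space M. X l \<omega> < 1} \<omega>)"
    if "\<omega> \<in> space M" for l \<omega>
    using that by (auto simp: g_def algebra_simps)
  have int: "integrable M (\<lambda>\<omega>. g (X l \<omega>))" if "1 \<le> l" for l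
    using X_integrable[OF that] b_integrable[OF that]
    by (simp add: g_X cong: Bochner_Integration.integrable_cong)
  have exp: "expectation (\<lambda>\<omega>. g (X l \<omega>)) = 1 - (1 - c) * b l" if "1 \<le> l" for l
    using X_integrable[OF that] b_integrable[OF that] X_expectation[OF that]
    by (simp add: g_X b_def cong: Bochner_Integration.integral_cong)
  have S_g: "S n \<omega> * c ^ drawdown_count S n \<omega> = (\<Prod>l=1..n. g (X l \<omega>))" if "\<omega> \<in> space M" for \<omega>
    using S_mult_power_drawdown_count[OF that] by (simp add: g_def)
  show "integrable M (\<lambda>\<omega>. S n \<omega> * c ^ drawdown_count S n \<omega>)"
    using expectation_prod_comp(1)[of "{1..n}" g] int
    by (simp add: S_g cong: Bochner_Integration.integrable_cong)
  have "expectation (\<lambda>\<omega>. S n \<omega> * c ^ drawdown_count S n \<omega>) = (\<Prod>l=1..n. expectation (\<lambda>\<omega>. g (X l \<omega>)))"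
    using expectation_prod_comp(2)[of "{1..n}" g] int
    by (simp add: S_g cong: Bochner_Integration.integral_cong)
  also have "\<dots> = (\<Prod>l=1..n. 1 - (1 - c) * b l)"
    by (intro prod.cong exp) auto
  also have "\<dots> = (\<Prod>i<n. 1 - (1 - c) * b (Suc i))"
    by (rule prod.reindex_bij_witness[of _ Suc "\<lambda>i. i - 1"]) auto
  finally show "expectation (\<lambda>\<omega>. S n \<omega> * c ^ drawdown_count S n \<omega>) = (\<Prod>i<n. 1 - (1 - c) * b (Suc i))" .
qed

text \<open>As \<open>0 ^ 0 = 1\<close>, the weight \<open>c = 0\<close> is exactly the indicator
  that no drawdown has occurred.\<close>

lemma expectation_S_survives_first:
  "expectation (\<lambda>\<omega>. S n \<omega> * survives 1 n \<omega>) = (\<Prod>i<n. 1 - b (Suc i))"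
proof -
  have "survives 1 n \<omega> = 0 ^ drawdown_count S n \<omega>" for \<omega>
    unfolding survives_def less_drawdown_time_iff by (simp add: power_0_left)
  then show ?thesis
    using S_mult_power_drawdown_count_expectation[of n 0] by simp
qed

text \<open>Before drawdown \<open>k\<close> the count is below \<open>k\<close>, so
  \<open>2 ^ k * (1 / 2) ^ count\<close> is at least 1 there and dominates the indicator.\<close>

lemma expectation_S_survives_le:
  "expectation (\<lambda>\<omega>. S n \<omega> * survives k n \<omega>) \<le> 2 ^ k * (\<Prod>i<n. 1 - b (Suc i) / 2)"
proof -
  have "survives k n \<omega> \<le> 2 ^ k * (1 / 2) ^ drawdown_count S n \<omega>" for \<omega>
  proof (cases "drawdown_count S n \<omega> < k")
    case True
    then have "(2::real) ^ drawdown_count S n \<omega> \<le> 2 ^ k"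
      by (intro power_increasing) auto
    then show ?thesis
      by (simp add: survives_def power_one_over)
  qed (simp add: survives_def less_drawdown_time_iff)
  then have "S n \<omega> * survives k n \<omega> \<le> 2 ^ k * (S n \<omega> * (1 / 2) ^ drawdown_count S n \<omega>)"
    if "\<omega> \<in> space M" for \<omega>
    using mult_left_mono[OF _ S_nonneg[OF that]] by (metis mult.left_commute)
  then have "expectation (\<lambda>\<omega>. S n \<omega> * survives k n \<omega>) \<le>
      expectation (\<lambda>\<omega>. 2 ^ k * (S n \<omega> * (1 / 2) ^ drawdown_count S n \<omega>))"
    by (intro integral_mono S_survives_integrable integrable_mult_right
        S_mult_power_drawdown_count_integrable)
  then show ?thesis
    using S_mult_power_drawdown_count_expectation[of n "1 / 2"] by simp
qed

section \<open>The case of non-summable \<open>a\<close>\<close>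

text \<open>The second Borel-Cantelli argument: by independence, no factor below 1 among the
  \<open>n\<close> after index \<open>m\<close> has probability the product of
  \<open>1 - a l\<close>, which tends to 0.\<close>

lemma AE_infinitely_many_below_1:
  assumes "\<not> summable (\<lambda>k. a (Suc k))"
  shows "AE \<omega> in M. \<forall>m. \<exists>i\<ge>m. X (Suc i) \<omega> < 1"
  unfolding AE_all_countable
proof
  fix m
  let ?A = "{\<omega> \<in> space M. \<forall>i\<ge>m. 1 \<le> X (Suc i) \<omega>}"
  have A: "?A \<in> events"
    by measurable
  have le: "prob ?A \<le> (\<Prod>i<n. 1 - a (Suc (i + m)))" for n
  proof -
    define g :: "real \<Rightarrow> real" where "g x = (if x < 1 then 0 else 1)" for x
    have [measurable]: "g \<in> borel_measurable borel"
      unfolding g_def by measurable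
    have g_X: "g (X l \<omega>) = 1 - indicator {\<omega> \<in> space M. X l \<omega> < 1} \<omega>" if "\<omega> \<in> space M" for l \<omega>
      using that by (auto simp: g_def)
    have ind: "integrable M (indicat_real {\<omega> \<in> space M. X l \<omega> < 1})" if "1 \<le> l" for l
      using X_less_1_set[OF that] by (intro integrable_real_indicator) (auto simp: emeasure_eq_measure)
    have int: "integrable M (\<lambda>\<omega>. g (X l \<omega>))" if "1 \<le> l" for l
      using ind[OF that]
      by (simp add: g_X del: integrable_indicator_iff cong: Bochner_Integration.integrable_cong)
    have exp: "expectation (\<lambda>\<omega>. g (X l \<omega>)) = 1 - a l" if "1 \<le> l" for l
      using ind[OF that]
      by (simp add: g_X a_eq_expectation[OF that] prob_space
          del: Bochner_Integration.integral_indicator integrable_indicator_iff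
          cong: Bochner_Integration.integral_cong)
    let ?I = "{Suc m..m + n}"
    have "prob ?A = expectation (indicator ?A)"
      using A by (simp add: Int_absorb2 subset_eq)
    also have "\<dots> \<le> expectation (\<lambda>\<omega>. \<Prod>l\<in>?I. g (X l \<omega>))"
    proof (rule integral_mono)
      show "indicator ?A \<omega> \<le> (\<Prod>l\<in>?I. g (X l \<omega>))" for \<omega>
      proof (cases "\<omega> \<in> ?A")
        case True
        have "g (X l \<omega>) = 1" if "l \<in> ?I" for l
          using that True by (cases l) (auto simp: g_def not_less)
        then show ?thesis
          by simp
      qed (auto simp: g_def intro!: prod_nonneg)
    qed (use A in \<open>auto simp: emeasure_eq_measure intro!: expectation_prod_comp(1) int\<close>)
    also have "\<dots> = (\<Prod>l\<in>?I. expectation (\<lambda>\<omega>. g (X l \<omega>)))"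
      by (rule expectation_prod_comp(2)) (auto intro: int)
    also have "\<dots> = (\<Prod>l\<in>?I. 1 - a l)"
      by (intro prod.cong exp) auto
    also have "\<dots> = (\<Prod>i<n. 1 - a (Suc (i + m)))"
      by (rule prod.reindex_bij_witness[of _ "\<lambda>i. Suc (i + m)" "\<lambda>l. l - Suc m"]) auto
    finally show ?thesis .
  qed
  have "(\<lambda>n. \<Prod>i<n. 1 - a (Suc (i + m))) \<longlonglongrightarrow> 0"
    using a_nonneg a_less_1 assms summable_iff_shift[of "\<lambda>k. a (Suc k)" m]
    by (intro prod_one_minus_tendsto_0) (auto simp: less_imp_le)
  then have "prob ?A \<le> 0"
    by (rule LIMSEQ_le_const) (use le in auto)
  then have "prob ?A = 0"
    by (simp add: antisym)
  then show "AE \<omega> in M. \<exists>i\<ge>m. X (Suc i) \<omega> < 1"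
    using A by (subst (asm) prob_eq_0) (auto simp: not_le)
qed

text \<open>While \<open>S\<close> stays positive, every factor below 1 is a drawdown. Infinitely
  many of them would make the \<open>k\<close>-th drawdown time finite, so \<open>S\<close> must hit
  zero, where it stays.\<close>

lemma S_eventually_0:
  assumes "\<omega> \<in> space M" and inf: "\<forall>m. \<exists>i\<ge>m. X (Suc i) \<omega> < 1"
    and never: "drawdown_time S k \<omega> = \<infinity>"
  shows "eventually (\<lambda>n. S n \<omega> = 0) sequentially"
proof -
  have "\<exists>m. S m \<omega> = 0"
  proof (rule ccontr)
    assume "\<nexists>m. S m \<omega> = 0"
    then have pos: "0 < S n \<omega>" for n
      using S_nonneg[OF assms(1), of n] by (metis less_eq_real_def)
    have "\<exists>n. K \<le> drawdown_count S n \<omega>" for K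
    proof (induction K)
      case (Suc K)
      then obtain n where n: "K \<le> drawdown_count S n \<omega>" by blast
      obtain i where i: "n \<le> i" "X (Suc i) \<omega> < 1"
        using inf by blast
      have "drawdown_count S n \<omega> \<le> drawdown_count S i \<omega>"
        unfolding drawdown_count_def using i by (intro sum_mono2) auto
      moreover have "S (Suc i) \<omega> < S i \<omega>"
        using pos[of i] i by (simp add: S_Suc mult_less_cancel_left2)
      ultimately show ?case
        using n by (intro exI[of _ "Suc i"]) (simp add: drawdown_count_def)
    qed simp
    then show False
      using never less_drawdown_time_iff[of _ S k \<omega>] by (auto simp: not_le[symmetric])
  qed
  then obtain m where "S m \<omega> = 0" by blast
  have "S n \<omega> = 0" if "m \<le> n" for n
    using that \<open>S m \<omega> = 0\<close> by (induction n rule: dec_induct) (simp_all add: S_Suc)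
  then show ?thesis
    by (rule eventually_sequentiallyI)
qed

text \<open>Removing the surviving part leaves the stopped value on the event that \<tau> is at most
  \<open>n\<close>. This increases to the full stopped value, because \<open>S\<close> vanishes
  eventually where \<tau> is \<infinity>; monotone convergence applies.\<close>

lemma expectation_stopped_value:
  assumes "\<not> summable (\<lambda>k. a (Suc k))"
    and "(\<lambda>n. expectation (\<lambda>\<omega>. S n \<omega> * survives k n \<omega>)) \<longlonglongrightarrow> L"
  shows "expectation (stopped_value S (drawdown_time S k)) = 1 - L"
proof (rule integral_monotone_convergence)
  let ?\<tau> = "drawdown_time S k"
  let ?Z = "\<lambda>n \<omega>. stopped_process S ?\<tau> n \<omega> - S n \<omega> * survives k n \<omega>"
  have Z: "?Z n \<omega> = (if enat n < ?\<tau> \<omega> then 0 else S (the_enat (?\<tau> \<omega>)) \<omega>)" for n \<omega>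
    by (simp add: stopped_process_def survives_def)
  show "integrable M (?Z n)" for n
    by (intro Bochner_Integration.integrable_diff stopped_process_integrable S_survives_integrable)
  show "AE \<omega> in M. mono (\<lambda>n. ?Z n \<omega>)"
    unfolding Z by (intro AE_I2 monoI) (auto simp: S_nonneg not_less dest: order_trans[of _ "enat _" "enat _"])
  show "AE \<omega> in M. (\<lambda>n. ?Z n \<omega>) \<longlonglongrightarrow> stopped_value S ?\<tau> \<omega>"
    using AE_infinitely_many_below_1[OF assms(1)] AE_space
  proof eventually_elim
    case (elim \<omega>)
    show ?case
    proof (cases "?\<tau> \<omega>")
      case (enat t)
      then show ?thesis
        unfolding Z by (intro tendsto_eventually eventually_sequentiallyI[of t])
          (auto simp: stopped_value_def)
    next
      case infinity
      then have "lim (\<lambda>n. S n \<omega>) = 0"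
        using S_eventually_0[of \<omega> k] elim by (intro limI tendsto_eventually) auto
      with infinity show ?thesis
        unfolding Z by (simp add: stopped_value_def)
    qed
  qed
  show "(\<lambda>n. expectation (?Z n)) \<longlonglongrightarrow> 1 - L"
    using assms(2)
    by (simp add: stopped_process_integrable S_survives_integrable stopped_process_expectation tendsto_diff)
  show "stopped_value S ?\<tau> \<in> borel_measurable M"
    by (rule stopped_value_measurable)
qed

section \<open>The case of summable \<open>a\<close>\<close>

text \<open>Independence and \<open>E[S n] = 1\<close> reduce this to \<open>X - 1\<close>. For
  \<open>x \<ge> 0\<close>, \<open>\<bar>x - 1\<bar>\<close> is at most \<open>x - 1\<close> plus
  twice the indicator of \<open>x < 1\<close>, and \<open>x - 1\<close> averages to zero.\<close>

lemma expectation_abs_increment_le: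
  "expectation (\<lambda>\<omega>. \<bar>S (Suc n) \<omega> - S n \<omega>\<bar>) \<le> 2 * a (Suc n)"
proof -
  let ?I = "{\<omega> \<in> space M. X (Suc n) \<omega> < 1}"
  have X_int: "integrable M (X (Suc n))"
    by (simp add: X_integrable)
  have I: "integrable M (indicat_real ?I)"
    by (intro integrable_real_indicator) (auto simp: emeasure_eq_measure)
  have "expectation (\<lambda>\<omega>. \<bar>S (Suc n) \<omega> - S n \<omega>\<bar>) = expectation (\<lambda>\<omega>. S n \<omega> * \<bar>X (Suc n) \<omega> - 1\<bar>)"
  proof (rule Bochner_Integration.integral_cong)
    fix \<omega> assume "\<omega> \<in> space M"
    then have "S n \<omega> * \<bar>X (Suc n) \<omega> - 1\<bar> = \<bar>S n \<omega> * (X (Suc n) \<omega> - 1)\<bar>"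
      by (simp add: abs_mult S_nonneg)
    then show "\<bar>S (Suc n) \<omega> - S n \<omega>\<bar> = S n \<omega> * \<bar>X (Suc n) \<omega> - 1\<bar>"
      by (simp add: S_Suc algebra_simps)
  qed simp
  also have "\<dots> = expectation (\<lambda>\<omega>. \<bar>X (Suc n) \<omega> - 1\<bar>)"
    using X_int
    by (subst expectation_mult_comp_X) (auto intro: S_measurable_F S_integrable simp: S_expectation)
  also have "\<dots> \<le> expectation (\<lambda>\<omega>. X (Suc n) \<omega> - 1 + 2 * indicat_real ?I \<omega>)"
    using X_int I X_nonneg[of "Suc n"]
    by (intro integral_mono) (auto split: split_indicator)
  also have "\<dots> = 2 * expectation (indicat_real ?I)"
    using X_int I X_expectation[of "Suc n"]
    by (simp add: prob_space del: Bochner_Integration.integral_indicator)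
  also have "\<dots> = 2 * a (Suc n)"
    using a_eq_expectation[of "Suc n"] by simp
  finally show ?thesis .
qed

lemma expectation_stopped_value_if_summable:
  assumes "summable (\<lambda>k. a (Suc k))"
  shows "expectation (stopped_value S (drawdown_time S k)) = 1"
proof -
  let ?\<tau> = "drawdown_time S k"
  let ?d = "\<lambda>i \<omega>. \<bar>S (Suc i) \<omega> - S i \<omega>\<bar>"
  have d_int: "integrable M (?d i)" for i
    by (simp add: S_integrable)
  have d_sum: "summable (\<lambda>i. expectation (?d i))"
  proof (rule summable_comparison_test'[where N = 0])
    show "summable (\<lambda>i. 2 * a (Suc i))"
      by (rule summable_mult[OF assms])
    show "norm (expectation (?d n)) \<le> 2 * a (Suc n)" for n
      using expectation_abs_increment_le[of n] by (simp add: integral_nonneg_AE)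
  qed
  \<comment> \<open>Tonelli: finite expected total variation forces almost every path to have finite
    total variation.\<close>
  have "(\<integral>\<^sup>+\<omega>. (\<Sum>i. ennreal (?d i \<omega>)) \<partial>M) = (\<Sum>i. \<integral>\<^sup>+\<omega>. ennreal (?d i \<omega>) \<partial>M)"
    by (rule nn_integral_suminf) simp
  also have "\<dots> = (\<Sum>i. ennreal (expectation (?d i)))"
    by (simp add: nn_integral_eq_integral d_int)
  also have "\<dots> \<noteq> \<infinity>"
    unfolding infinity_ennreal_def by (rule ennreal_suminf_neq_top[OF d_sum]) simp
  finally have "AE \<omega> in M. (\<Sum>i. ennreal (?d i \<omega>)) \<noteq> \<infinity>"
    by (intro nn_integral_noteq_infinite) simp_all
  then have AE_d: "AE \<omega> in M. summable (\<lambda>i. ?d i \<omega>)"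
    by eventually_elim (auto intro: summable_suminf_not_top)
  have "(\<lambda>n. expectation (stopped_process S ?\<tau> n)) \<longlonglongrightarrow> expectation (stopped_value S ?\<tau>)"
  proof (rule integral_dominated_convergence[where w = "\<lambda>\<omega>. 1 + (\<Sum>i. ?d i \<omega>)"])
    have "integrable M (\<lambda>\<omega>. \<Sum>i. ?d i \<omega>)"
      by (rule integrable_suminf) (use AE_d d_sum d_int in simp_all)
    then show "integrable M (\<lambda>\<omega>. 1 + (\<Sum>i. ?d i \<omega>))"
      by simp
    show "AE \<omega> in M. (\<lambda>n. stopped_process S ?\<tau> n \<omega>) \<longlonglongrightarrow> stopped_value S ?\<tau> \<omega>"
      using AE_d
    proof eventually_elim
      case (elim \<omega>)
      \<comment> \<open>Telescoping absolutely summable increments shows that the path converges, so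
        \<open>lim\<close> is a genuine limit where \<tau> is \<infinity>.\<close>
      have "convergent (\<lambda>n. \<Sum>i<n. S (Suc i) \<omega> - S i \<omega>)"
        using summable_rabs_cancel[OF elim] by (simp add: summable_iff_convergent)
      then have "convergent (\<lambda>n. S n \<omega>)"
        using convergent_add[OF convergent_const[of 1], of "\<lambda>n. \<Sum>i<n. S (Suc i) \<omega> - S i \<omega>"]
        by (simp add: sum_lessThan_telescope[of "\<lambda>n. S n \<omega>"])
      then show ?case
        by (rule stopped_process_tendsto)
    qed
    show "AE \<omega> in M. norm (stopped_process S ?\<tau> n \<omega>) \<le> 1 + (\<Sum>i. ?d i \<omega>)" for n
      using AE_d
    proof eventually_elim
      case (elim \<omega>)
      have "\<bar>stopped_process S ?\<tau> n \<omega>\<bar> \<le> 1 + (\<Sum>i<n. ?d i \<omega>)"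
      proof (induction n)
        case (Suc n)
        have "\<bar>stopped_process S ?\<tau> (Suc n) \<omega>\<bar> \<le> \<bar>stopped_process S ?\<tau> n \<omega>\<bar> + ?d n \<omega>"
          by (auto simp: stopped_process_Suc)
        then show ?case
          using Suc by simp
      qed (simp add: stopped_process_0)
      also have "\<dots> \<le> 1 + (\<Sum>i. ?d i \<omega>)"
        using elim by (intro add_left_mono sum_le_suminf) auto
      finally show ?case by simp
    qed
  qed (use stopped_process_integrable in \<open>auto intro: stopped_value_measurable\<close>)
  then show ?thesis
    by (simp add: stopped_process_expectation LIMSEQ_const_iff)
qed

section \<open>The equivalence\<close>

lemma bubble_S_iff:
  "bubble M F S \<longleftrightarrow> \<not> summable (\<lambda>k. a (Suc k)) \<and> summable (\<lambda>k. b (Suc k))"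
proof -
  have b_Suc: "0 \<le> b (Suc i)" "b (Suc i) < 1" for i
    using a_b_range[of "Suc i"] by auto
  have bubble: "bubble M F S \<longleftrightarrow> (\<exists>k\<ge>1. expectation (stopped_value S (drawdown_time S k)) < 1)"
    by (simp add: bubble_def nonneg_martingale_S prob_space)
  show ?thesis
  proof (cases "summable (\<lambda>k. a (Suc k))")
    case True
    then show ?thesis
      by (simp add: bubble expectation_stopped_value_if_summable)
  next
    case a_div: False
    show ?thesis
    proof (cases "summable (\<lambda>k. b (Suc k))")
      case True
      \<comment> \<open>The first drawdown is the witness: its lost mass is \<open>c\<close>,
        positive since \<open>b \<le> a < 1\<close> keeps every factor positive.\<close>
      obtain c where "0 < c" and "(\<lambda>n. \<Prod>i<n. 1 - b (Suc i)) \<longlonglongrightarrow> c"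
        using prod_one_minus_tendsto_pos[OF b_Suc True] .
      then have "expectation (stopped_value S (drawdown_time S 1)) < 1"
        using expectation_stopped_value[OF a_div, of 1 c] unfolding expectation_S_survives_first by simp
      then show ?thesis
        using a_div True bubble by blast
    next
      case b_div: False
      have "expectation (stopped_value S (drawdown_time S k)) = 1" for k
      proof -
        \<comment> \<open>The halves come from the weight \<open>1 / 2\<close> in the bound on the
          surviving mass; the constant \<open>2 ^ k\<close> does not disturb the limit 0.\<close>
        have "(\<lambda>n. \<Prod>i<n. 1 - b (Suc i) / 2) \<longlonglongrightarrow> 0"
        proof (rule prod_one_minus_tendsto_0)
          show "b (Suc i) / 2 \<le> 1" for i
            using b_Suc(2)[of i] by simp
          show "\<not> summable (\<lambda>i. b (Suc i) / 2)"
            using b_div summable_mult[of "\<lambda>i. b (Suc i) / 2" 2] by auto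
        qed (simp add: b_Suc)
        then have upper: "(\<lambda>n. 2 ^ k * (\<Prod>i<n. 1 - b (Suc i) / 2)) \<longlonglongrightarrow> 0"
          by (rule tendsto_mult_right_zero)
        have "0 \<le> expectation (\<lambda>\<omega>. S n \<omega> * survives k n \<omega>)" for n
          by (intro integral_nonneg_AE AE_I2) (simp add: S_nonneg survives_def)
        then have "(\<lambda>n. expectation (\<lambda>\<omega>. S n \<omega> * survives k n \<omega>)) \<longlonglongrightarrow> 0"
          by (intro tendsto_sandwich[OF _ _ tendsto_const upper] always_eventually allI
              expectation_S_survives_le)
        then show ?thesis
          using expectation_stopped_value[OF a_div, of k 0] by simp
      qed
      then show ?thesis
        using b_div by (simp add: bubble)
    qed
  qed
qed

end

text \<open>Links the extended sums, where divergence means the value \<infinity>, to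
  \<open>summable\<close>; nonnegativity keeps \<open>ennreal\<close> from truncating terms.\<close>

lemma suminf_ennreal_less_top_iff:
  assumes "\<And>i. 0 \<le> f i"
  shows "(\<Sum>i. ennreal (f i)) < \<infinity> \<longleftrightarrow> summable f"
  using summable_suminf_not_top[of f, OF assms] ennreal_suminf_neq_top[of f, OF _ assms]
  unfolding infinity_ennreal_def less_top[symmetric] by blast

theorem theorem1p7:
  fixes M :: "'a measure" and X S :: "nat \<Rightarrow> 'a \<Rightarrow> real"
    and F :: "nat \<Rightarrow> 'a measure" and a b :: "nat \<Rightarrow> real"
  assumes "prob_space M"
    and "prob_space.indep_vars M (\<lambda>_. borel) X {1..}"
    and "\<And>k \<omega>. k \<ge> 1 \<Longrightarrow> \<omega> \<in> space M \<Longrightarrow> 0 \<le> X k \<omega>"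
    and "\<And>k. k \<ge> 1 \<Longrightarrow> integrable M (X k)"
    and "\<And>k. k \<ge> 1 \<Longrightarrow> (\<integral>\<omega>. X k \<omega> \<partial>M) = 1"
    and "S = (\<lambda>k \<omega>. \<Prod>l=1..k. X l \<omega>)"
    and "F = natural_filtration M S"
    and "\<And>k. k \<ge> 1 \<Longrightarrow> a k = measure M {\<omega> \<in> space M. X k \<omega> < 1}"
    and "\<And>k. k \<ge> 1 \<Longrightarrow> b k = (\<integral>\<omega>. X k \<omega> * indicator {\<omega> \<in> space M. X k \<omega> < 1} \<omega> \<partial>M)"
  shows "(\<forall>k\<ge>1. a k \<in> {0..<1} \<and> b k \<in> {0..a k}) \<and>
         nonneg_martingale M F S \<and>
         (bubble M F S \<longleftrightarrow>
            (\<Sum>k. ennreal (a (Suc k))) = \<infinity> \<and> (\<Sum>k. ennreal (b (Suc k))) < \<infinity>)"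
proof -
  interpret prob_space M by fact
  interpret U: unit_mean_factors M X
    by standard (fact assms(2-5))+
  have S: "S = U.S"
    by (simp add: assms(6) U.S_def fun_eq_iff)
  have a: "a k = U.a k" and b: "b k = U.b k" if "1 \<le> k" for k
    using assms(8,9)[OF that] by (simp_all add: U.a_def U.b_def)
  have range: "\<forall>k\<ge>1. a k \<in> {0..<1} \<and> b k \<in> {0..a k}"
    using U.a_b_range by (simp add: a b)
  then have "0 \<le> a (Suc k)" "0 \<le> b (Suc k)" for k
    by auto
  then have "(\<Sum>k. ennreal (a (Suc k))) < \<infinity> \<longleftrightarrow> summable (\<lambda>k. a (Suc k))"
    and "(\<Sum>k. ennreal (b (Suc k))) < \<infinity> \<longleftrightarrow> summable (\<lambda>k. b (Suc k))"
    by (intro suminf_ennreal_less_top_iff; simp)+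
  then have "bubble M F S \<longleftrightarrow>
      (\<Sum>k. ennreal (a (Suc k))) = \<infinity> \<and> (\<Sum>k. ennreal (b (Suc k))) < \<infinity>"
    using U.bubble_S_iff unfolding assms(7) S by (auto simp: a b less_top[symmetric])
  with range show ?thesis
    using U.nonneg_martingale_S unfolding assms(7) S by blast
qed

end
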